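(* Let $K$ be a loopfree category and let a group $G$ act on $K$. The following two assertions are equivalent: (1) Condition (SR): if $x,y$ are morphisms of $K$ with $\partial^\bullet x=\partial^\bullet y$ and $G\partial_\bullet x=G\partial_\bullet y$, then $Gx=Gy$. (2) $G$ acts regularly on $K$ and $K/G$ is a poset.
   Context: For a morphism $m$, $\partial^\bullet m$ denotes its source and $\partial_\bullet m$ its target; $x\circ y$ is defined when $\partial_\bullet x=\partial^\bullet y$ (first $x$, then $y$). A small category is loopfree if only identity morphisms have inverses and every endomorphism is an identity; equivalently, for objects $x\ne y$ at most one of the sets of morphisms $x\to y$ and $y\to x$ is nonempty, and the only morphism $x\to x$ is the identity. A poset is regarded as a category with at most one morphism between any two objects. $G$ (viewed as a one-object category) acts on $K$ via a functor $G\to\mathbf{Cat}$ sending the object to $K$; $Gm$ denotes the orbit of an object or morphism $m$. $G$ acts regularly if: whenever $x,y_a,y_b$ are morphisms with $\partial_\bullet x=\partial^\bullet y_a=\partial^\bullet y_b$ and $Gy_a=Gy_b$, then $G(x\circ y_a)=G(x\circ y_b)$. $K/G$ is the colimit in $\mathbf{Cat}$ of the action functor; explicitly, its objects are the $G$-orbits of objects of $K$, and its morphisms are the equivalence classes of morphisms of $K$ under the transitive closure of the relation "$x$ and $y$ have decompositions $x=x_1\circ\dots\circ x_s$, $y=y_1\circ\dots\circ y_s$ with $Gx_i=Gy_i$ for all $i$", with induced source, target and composition. *)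

theory Defs
  imports "HOL-Algebra.Group_Action"
begin

section \<open>Small categories\<close>

text \<open>Composition is written in diagrammatic order: \<open>x \<Zcomp> y\<close> means first \<open>x\<close>, then \<open>y\<close>.
  Its value is irrelevant unless \<open>Tgt x = Src y\<close>.\<close>

record ('o, 'm) cat =
  Obj :: "'o set"
  Mor :: "'m set"
  Src :: "'m \<Rightarrow> 'o"
  Tgt :: "'m \<Rightarrow> 'o"
  Idn :: "'o \<Rightarrow> 'm"
  Cmp :: "'m \<Rightarrow> 'm \<Rightarrow> 'm"  (infixl "\<Zcomp>\<index>" 70)

locale category =
  fixes K :: "('o, 'm) cat"
  assumes Src_in: "x \<in> Mor K \<Longrightarrow> Src K x \<in> Obj K"
    and Tgt_in: "x \<in> Mor K \<Longrightarrow> Tgt K x \<in> Obj K"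
    and Idn_in: "a \<in> Obj K \<Longrightarrow> Idn K a \<in> Mor K"
    and Src_Idn: "a \<in> Obj K \<Longrightarrow> Src K (Idn K a) = a"
    and Tgt_Idn: "a \<in> Obj K \<Longrightarrow> Tgt K (Idn K a) = a"
    and Cmp_in: "\<lbrakk>x \<in> Mor K; y \<in> Mor K; Tgt K x = Src K y\<rbrakk> \<Longrightarrow> x \<Zcomp>\<^bsub>K\<^esub> y \<in> Mor K"
    and Src_Cmp: "\<lbrakk>x \<in> Mor K; y \<in> Mor K; Tgt K x = Src K y\<rbrakk> \<Longrightarrow> Src K (x \<Zcomp>\<^bsub>K\<^esub> y) = Src K x"
    and Tgt_Cmp: "\<lbrakk>x \<in> Mor K; y \<in> Mor K; Tgt K x = Src K y\<rbrakk> \<Longrightarrow> Tgt K (x \<Zcomp>\<^bsub>K\<^esub> y) = Tgt K y"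
    and Idn_Cmp: "x \<in> Mor K \<Longrightarrow> Idn K (Src K x) \<Zcomp>\<^bsub>K\<^esub> x = x"
    and Cmp_Idn: "x \<in> Mor K \<Longrightarrow> x \<Zcomp>\<^bsub>K\<^esub> Idn K (Tgt K x) = x"
    and Cmp_assoc: "\<lbrakk>x \<in> Mor K; y \<in> Mor K; z \<in> Mor K; Tgt K x = Src K y; Tgt K y = Src K z\<rbrakk>
      \<Longrightarrow> (x \<Zcomp>\<^bsub>K\<^esub> y) \<Zcomp>\<^bsub>K\<^esub> z = x \<Zcomp>\<^bsub>K\<^esub> (y \<Zcomp>\<^bsub>K\<^esub> z)"

definition inverse_morphisms :: "('o, 'm) cat \<Rightarrow> 'm \<Rightarrow> 'm \<Rightarrow> bool" where
  "inverse_morphisms K x y \<longleftrightarrow> x \<in> Mor K \<and> y \<in> Mor K \<and> Tgt K x = Src K y \<and> Tgt K y = Src K x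
     \<and> x \<Zcomp>\<^bsub>K\<^esub> y = Idn K (Src K x) \<and> y \<Zcomp>\<^bsub>K\<^esub> x = Idn K (Src K y)"

locale loopfree_category = category +
  assumes invertible_is_identity: "inverse_morphisms K x y \<Longrightarrow> x = Idn K (Src K x)"
    and endomorphism_is_identity: "\<lbrakk>x \<in> Mor K; Src K x = Tgt K x\<rbrakk> \<Longrightarrow> x = Idn K (Src K x)"

text \<open>A poset regarded as a category: there is at most one morphism between any two objects, and
  existence of a morphism is a partial order on the objects (in particular antisymmetric).\<close>

locale poset_category = category +
  assumes parallel_eq: "\<lbrakk>x \<in> Mor K; y \<in> Mor K; Src K x = Src K y; Tgt K x = Tgt K y\<rbrakk> \<Longrightarrow> x = y"
    and partial_order: "partial_order_on (Obj K) {(Src K x, Tgt K x) | x. x \<in> Mor K}"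

locale cat_functor = source: category K + target: category L
  for K :: "('o, 'm) cat" and L :: "('p, 'n) cat" and F :: "'o \<Rightarrow> 'p" and H :: "'m \<Rightarrow> 'n" +
  assumes obj_in: "a \<in> Obj K \<Longrightarrow> F a \<in> Obj L"
    and mor_in: "x \<in> Mor K \<Longrightarrow> H x \<in> Mor L"
    and Src_mor: "x \<in> Mor K \<Longrightarrow> Src L (H x) = F (Src K x)"
    and Tgt_mor: "x \<in> Mor K \<Longrightarrow> Tgt L (H x) = F (Tgt K x)"
    and mor_Idn: "a \<in> Obj K \<Longrightarrow> H (Idn K a) = Idn L (F a)"
    and mor_Cmp: "\<lbrakk>x \<in> Mor K; y \<in> Mor K; Tgt K x = Src K y\<rbrakk>
      \<Longrightarrow> H (x \<Zcomp>\<^bsub>K\<^esub> y) = H x \<Zcomp>\<^bsub>L\<^esub> H y"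


section \<open>Group actions on categories\<close>

text \<open>Each \<open>g\<close> acts by the functor with object map \<open>\<phi> g\<close> and morphism map \<open>\<psi> g\<close>; that these
  functors depend functorially on \<open>g\<close> is expressed by \<open>\<phi>\<close> and \<open>\<psi>\<close> being group actions on
  the sets of objects and of on_Mor.\<close>

locale category_action =
  category K + on_Obj: group_action G "Obj K" \<phi> + on_Mor: group_action G "Mor K" \<psi>
  for G :: "('g, 'r) monoid_scheme" and K :: "('o, 'm) cat"
    and \<phi> :: "'g \<Rightarrow> 'o \<Rightarrow> 'o" and \<psi> :: "'g \<Rightarrow> 'm \<Rightarrow> 'm" +
  assumes acts_by_functors: "g \<in> carrier G \<Longrightarrow> cat_functor K K (\<phi> g) (\<psi> g)"

definition acts_regularly ::
  "('g, 'r) monoid_scheme \<Rightarrow> ('o, 'm) cat \<Rightarrow> ('g \<Rightarrow> 'm \<Rightarrow> 'm) \<Rightarrow> bool" where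
  "acts_regularly G K \<psi> \<longleftrightarrow> (\<forall>x \<in> Mor K. \<forall>y \<in> Mor K. \<forall>y' \<in> Mor K.
     Tgt K x = Src K y \<and> Tgt K x = Src K y' \<and> orbit G \<psi> y = orbit G \<psi> y'
     \<longrightarrow> orbit G \<psi> (x \<Zcomp>\<^bsub>K\<^esub> y) = orbit G \<psi> (x \<Zcomp>\<^bsub>K\<^esub> y'))"

definition condition_SR ::
  "('g, 'r) monoid_scheme \<Rightarrow> ('o, 'm) cat \<Rightarrow> ('g \<Rightarrow> 'o \<Rightarrow> 'o) \<Rightarrow> ('g \<Rightarrow> 'm \<Rightarrow> 'm) \<Rightarrow> bool" where
  "condition_SR G K \<phi> \<psi> \<longleftrightarrow> (\<forall>x \<in> Mor K. \<forall>y \<in> Mor K.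
     Src K x = Src K y \<and> orbit G \<phi> (Tgt K x) = orbit G \<phi> (Tgt K y)
     \<longrightarrow> orbit G \<psi> x = orbit G \<psi> y)"


section \<open>The quotient category\<close>

text \<open>\<open>decomposition K xs x\<close>: \<open>xs\<close> is a nonempty composable sequence of morphisms with composite \<open>x\<close>.\<close>

inductive decomposition :: "('o, 'm) cat \<Rightarrow> 'm list \<Rightarrow> 'm \<Rightarrow> bool" for K where
  single: "x \<in> Mor K \<Longrightarrow> decomposition K [x] x"
| cons: "\<lbrakk>x \<in> Mor K; decomposition K ys y; Tgt K x = Src K y\<rbrakk>
    \<Longrightarrow> decomposition K (x # ys) (x \<Zcomp>\<^bsub>K\<^esub> y)"

definition quotient_step ::
  "('g, 'r) monoid_scheme \<Rightarrow> ('o, 'm) cat \<Rightarrow> ('g \<Rightarrow> 'm \<Rightarrow> 'm) \<Rightarrow> 'm rel" where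
  "quotient_step G K \<psi> = {(x, y). \<exists>xs ys. decomposition K xs x \<and> decomposition K ys y
     \<and> list_all2 (\<lambda>u v. orbit G \<psi> u = orbit G \<psi> v) xs ys}"

definition quotient_rel ::
  "('g, 'r) monoid_scheme \<Rightarrow> ('o, 'm) cat \<Rightarrow> ('g \<Rightarrow> 'm \<Rightarrow> 'm) \<Rightarrow> 'm rel" where
  "quotient_rel G K \<psi> = (quotient_step G K \<psi>)\<^sup>+"

definition quotient_class ::
  "('g, 'r) monoid_scheme \<Rightarrow> ('o, 'm) cat \<Rightarrow> ('g \<Rightarrow> 'm \<Rightarrow> 'm) \<Rightarrow> 'm \<Rightarrow> 'm set" where
  "quotient_class G K \<psi> x = quotient_rel G K \<psi> `` {x}"

text \<open>The structure maps are induced from representatives: each \<open>the_elem\<close> below is applied to a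
  singleton set, by \<open>Src_quotient\<close>, \<open>Tgt_quotient\<close>, \<open>Idn_quotient\<close> and \<open>Cmp_quotient\<close>.\<close>

definition quotient_category ::
  "('g, 'r) monoid_scheme \<Rightarrow> ('o, 'm) cat \<Rightarrow> ('g \<Rightarrow> 'o \<Rightarrow> 'o) \<Rightarrow> ('g \<Rightarrow> 'm \<Rightarrow> 'm)
     \<Rightarrow> ('o set, 'm set) cat" where
  "quotient_category G K \<phi> \<psi> =
    \<lparr>Obj = orbits G (Obj K) \<phi>,
     Mor = Mor K // quotient_rel G K \<psi>,
     Src = (\<lambda>X. the_elem {orbit G \<phi> (Src K x) | x. x \<in> X}),
     Tgt = (\<lambda>X. the_elem {orbit G \<phi> (Tgt K x) | x. x \<in> X}),
     Idn = (\<lambda>A. the_elem {quotient_class G K \<psi> (Idn K a) | a. a \<in> A}),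
     Cmp = (\<lambda>X Y. the_elem {quotient_class G K \<psi> (x \<Zcomp>\<^bsub>K\<^esub> y) | x y.
                               x \<in> X \<and> y \<in> Y \<and> Tgt K x = Src K y})\<rparr>"

context category_action
begin

abbreviation "orbO \<equiv> orbit G \<phi>"
abbreviation "orbM \<equiv> orbit G \<psi>"
abbreviation "step \<equiv> quotient_step G K \<psi>"
abbreviation "rel \<equiv> quotient_rel G K \<psi>"
abbreviation "cls \<equiv> quotient_class G K \<psi>"
abbreviation "Q \<equiv> quotient_category G K \<phi> \<psi>"

lemma group_G: "group G"
  using on_Obj.group_hom group_hom.axioms(1) by blast

lemmas functor_simps = cat_functor.obj_in[OF acts_by_functors] cat_functor.mor_in[OF acts_by_functors]
  cat_functor.Src_mor[OF acts_by_functors] cat_functor.Tgt_mor[OF acts_by_functors]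
  cat_functor.mor_Idn[OF acts_by_functors] cat_functor.mor_Cmp[OF acts_by_functors]

lemma orbO_eq_iff:
  assumes "a \<in> Obj K" "b \<in> Obj K"
  shows "orbO a = orbO b \<longleftrightarrow> (\<exists>g \<in> carrier G. b = \<phi> g a)"
proof
  assume "orbO a = orbO b"
  then show "\<exists>g \<in> carrier G. b = \<phi> g a"
    using on_Obj.orbit_refl[OF assms(2)] by (auto simp: orbit_def)
next
  assume "\<exists>g \<in> carrier G. b = \<phi> g a"
  then have b: "b \<in> orbO a" by (auto simp: orbit_def)
  have sub: "orbO c \<subseteq> Obj K" if "c \<in> Obj K" for c
    using that by (auto simp: orbit_def functor_simps)
  have a: "a \<in> orbO b"
    using on_Obj.orbit_sym[OF assms b] .
  show "orbO a = orbO b"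
  proof
    show "orbO a \<subseteq> orbO b"
      using sub[OF assms(1)] on_Obj.orbit_trans[OF assms(2,1) _ a] by auto
    show "orbO b \<subseteq> orbO a"
      using sub[OF assms(2)] on_Obj.orbit_trans[OF assms _ b] by auto
  qed
qed

lemma orbM_eq_iff:
  assumes "x \<in> Mor K" "y \<in> Mor K"
  shows "orbM x = orbM y \<longleftrightarrow> (\<exists>g \<in> carrier G. y = \<psi> g x)"
proof
  assume "orbM x = orbM y"
  then show "\<exists>g \<in> carrier G. y = \<psi> g x"
    using on_Mor.orbit_refl[OF assms(2)] by (auto simp: orbit_def)
next
  assume "\<exists>g \<in> carrier G. y = \<psi> g x"
  then have b: "y \<in> orbM x" by (auto simp: orbit_def)
  have sub: "orbM c \<subseteq> Mor K" if "c \<in> Mor K" for c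
    using that by (auto simp: orbit_def functor_simps)
  have a: "x \<in> orbM y"
    using on_Mor.orbit_sym[OF assms b] .
  show "orbM x = orbM y"
  proof
    show "orbM x \<subseteq> orbM y"
      using sub[OF assms(1)] on_Mor.orbit_trans[OF assms(2,1) _ a] by auto
    show "orbM y \<subseteq> orbM x"
      using sub[OF assms(2)] on_Mor.orbit_trans[OF assms _ b] by auto
  qed
qed

lemma orbM_act: "\<lbrakk>g \<in> carrier G; x \<in> Mor K\<rbrakk> \<Longrightarrow> orbM (\<psi> g x) = orbM x"
  using orbM_eq_iff[of x "\<psi> g x"] by (auto simp: functor_simps)

lemma orbO_act: "\<lbrakk>g \<in> carrier G; a \<in> Obj K\<rbrakk> \<Longrightarrow> orbO (\<phi> g a) = orbO a"
  using orbO_eq_iff[of a "\<phi> g a"] by (auto simp: functor_simps)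

lemma orbM_imp_orbO:
  assumes "x \<in> Mor K" "y \<in> Mor K" "orbM x = orbM y"
  shows "orbO (Src K x) = orbO (Src K y)" "orbO (Tgt K x) = orbO (Tgt K y)"
  using assms orbM_eq_iff[of x y] by (auto simp: functor_simps orbO_act Src_in Tgt_in)

lemma decomposition_Mor: "decomposition K xs x \<Longrightarrow> x \<in> Mor K"
  by (induction rule: decomposition.induct) (auto simp: Cmp_in)

lemma decomposition_set: "decomposition K xs x \<Longrightarrow> xs \<noteq> [] \<and> set xs \<subseteq> Mor K"
  by (induction rule: decomposition.induct) auto

lemma decomposition_Src: "decomposition K xs x \<Longrightarrow> Src K x = Src K (hd xs)"
  by (induction rule: decomposition.induct) (auto simp: Src_Cmp decomposition_Mor)

lemma decomposition_Tgt: "decomposition K xs x \<Longrightarrow> Tgt K x = Tgt K (last xs)"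
  by (induction rule: decomposition.induct)
    (auto simp: Tgt_Cmp decomposition_Mor dest: decomposition_set)

lemma decomposition_append:
  "\<lbrakk>decomposition K xs x; decomposition K ys y; Tgt K x = Src K y\<rbrakk>
    \<Longrightarrow> decomposition K (xs @ ys) (x \<Zcomp>\<^bsub>K\<^esub> y)"
proof (induction rule: decomposition.induct)
  case (single x)
  then show ?case by (auto intro: decomposition.cons)
next
  case (cons x zs z)
  have m: "x \<in> Mor K" "z \<in> Mor K" "y \<in> Mor K"
    using cons decomposition_Mor by auto
  have t: "Tgt K z = Src K y"
    using cons m by (simp add: Tgt_Cmp)
  have "decomposition K (x # (zs @ ys)) (x \<Zcomp>\<^bsub>K\<^esub> (z \<Zcomp>\<^bsub>K\<^esub> y))"
    using cons t m by (intro decomposition.cons) (auto simp: Src_Cmp)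
  then show ?case using m t cons by (simp add: Cmp_assoc)
qed

lemma step_Mor: "(x, y) \<in> step \<Longrightarrow> x \<in> Mor K \<and> y \<in> Mor K"
  unfolding quotient_step_def using decomposition_Mor by auto

lemma step_orbO:
  assumes "(x, y) \<in> step"
  shows "orbO (Src K x) = orbO (Src K y)" "orbO (Tgt K x) = orbO (Tgt K y)"
proof -
  obtain xs ys where d: "decomposition K xs x" "decomposition K ys y"
    and l: "list_all2 (\<lambda>u v. orbM u = orbM v) xs ys"
    using assms unfolding quotient_step_def by auto
  have ne: "xs \<noteq> []" "ys \<noteq> []" "set xs \<subseteq> Mor K" "set ys \<subseteq> Mor K"
    using d decomposition_set by auto
  have 1: "orbM (hd xs) = orbM (hd ys)"
    using l ne by (cases xs; cases ys) auto
  have 2: "orbM (last xs) = orbM (last ys)"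
    using l ne by (auto simp: last_conv_nth list_all2_conv_all_nth)
  have m: "hd xs \<in> Mor K" "hd ys \<in> Mor K" "last xs \<in> Mor K" "last ys \<in> Mor K"
    using ne hd_in_set last_in_set by blast+
  show "orbO (Src K x) = orbO (Src K y)"
    using orbM_imp_orbO(1)[OF m(1,2) 1] d by (simp add: decomposition_Src)
  show "orbO (Tgt K x) = orbO (Tgt K y)"
    using orbM_imp_orbO(2)[OF m(3,4) 2] d by (simp add: decomposition_Tgt)
qed

lemma step_sym:
  assumes "(x, y) \<in> step"
  shows "(y, x) \<in> step"
proof -
  obtain xs ys where "decomposition K xs x" "decomposition K ys y"
    and l: "list_all2 (\<lambda>u v. orbM u = orbM v) xs ys"
    using assms unfolding quotient_step_def by auto
  moreover have "list_all2 (\<lambda>u v. orbM u = orbM v) ys xs"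
    using l by (simp add: list_all2_conv_all_nth)
  ultimately show ?thesis unfolding quotient_step_def by blast
qed

lemma step_orbM:
  assumes "x \<in> Mor K" "y \<in> Mor K" "orbM x = orbM y"
  shows "(x, y) \<in> step"
proof -
  have "list_all2 (\<lambda>u v. orbM u = orbM v) [x] [y]" using assms by simp
  then show ?thesis
    unfolding quotient_step_def using assms(1,2)[THEN decomposition.single] by blast
qed

lemma step_Cmp:
  assumes "(x, x') \<in> step" "(y, y') \<in> step" "Tgt K x = Src K y" "Tgt K x' = Src K y'"
  shows "(x \<Zcomp>\<^bsub>K\<^esub> y, x' \<Zcomp>\<^bsub>K\<^esub> y') \<in> step"
proof -
  obtain xs xs' ys ys' where "decomposition K xs x" "decomposition K xs' x'"
    "list_all2 (\<lambda>u v. orbM u = orbM v) xs xs'"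
    "decomposition K ys y" "decomposition K ys' y'" 
    "list_all2 (\<lambda>u v. orbM u = orbM v) ys ys'"
    using assms(1,2) unfolding quotient_step_def by auto
  then have "decomposition K (xs @ ys) (x \<Zcomp>\<^bsub>K\<^esub> y)"
    "decomposition K (xs' @ ys') (x' \<Zcomp>\<^bsub>K\<^esub> y')"
    "list_all2 (\<lambda>u v. orbM u = orbM v) (xs @ ys) (xs' @ ys')"
    using decomposition_append assms(3,4) list_all2_appendI by simp_all
  then show ?thesis unfolding quotient_step_def by blast
qed

lemma rel_Mor: "(x, y) \<in> rel \<Longrightarrow> x \<in> Mor K \<and> y \<in> Mor K"
  unfolding quotient_rel_def by (induction rule: trancl.induct) (auto dest: step_Mor)

lemma rel_orbO:
  "(x, y) \<in> rel \<Longrightarrow> orbO (Src K x) = orbO (Src K y) \<and> orbO (Tgt K x) = orbO (Tgt K y)"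
  unfolding quotient_rel_def by (induction rule: trancl.induct) (auto dest: step_orbO)

lemma rel_step: "(x, y) \<in> step \<Longrightarrow> (x, y) \<in> rel"
  unfolding quotient_rel_def by auto

lemma rel_trans: "(x, y) \<in> rel \<Longrightarrow> (y, z) \<in> rel \<Longrightarrow> (x, z) \<in> rel"
  unfolding quotient_rel_def by (rule trancl_trans)

lemma rel_act: "\<lbrakk>g \<in> carrier G; x \<in> Mor K\<rbrakk> \<Longrightarrow> (x, \<psi> g x) \<in> rel"
  by (simp add: rel_step step_orbM orbM_act functor_simps)

lemma equiv_rel: "equiv (Mor K) rel"
proof (rule equivI)
  show "rel \<subseteq> Mor K \<times> Mor K" using rel_Mor by auto
  show "refl_on (Mor K) rel" by (auto intro!: refl_onI rel_step step_orbM)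
  show "sym rel"
    unfolding quotient_rel_def by (intro sym_trancl symI) (rule step_sym)
  show "trans rel" unfolding quotient_rel_def by simp
qed

lemma rel_Cmp_left:
  "\<lbrakk>(x, x') \<in> rel; y \<in> Mor K; Tgt K x = Src K y\<rbrakk>
    \<Longrightarrow> \<exists>g \<in> carrier G. Tgt K x' = Src K (\<psi> g y) \<and> (x \<Zcomp>\<^bsub>K\<^esub> y, x' \<Zcomp>\<^bsub>K\<^esub> \<psi> g y) \<in> rel"
  unfolding quotient_rel_def
proof (induction rule: trancl.induct)
  case (r_into_trancl x x')
  have m: "x \<in> Mor K" "x' \<in> Mor K" using r_into_trancl step_Mor by auto
  obtain g where g: "g \<in> carrier G" "Tgt K x' = \<phi> g (Tgt K x)"
    using step_orbO(2)[OF r_into_trancl(1)] orbO_eq_iff m Tgt_in by auto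
  have t: "Tgt K x' = Src K (\<psi> g y)" using g r_into_trancl by (simp add: functor_simps)
  have "(y, \<psi> g y) \<in> step" using g r_into_trancl by (simp add: step_orbM orbM_act functor_simps)
  from step_Cmp[OF r_into_trancl(1) this r_into_trancl(3) t] show ?case
    using g(1) t by blast
next
  case (trancl_into_trancl x u v)
  obtain g where g: "g \<in> carrier G" "Tgt K u = Src K (\<psi> g y)"
    "(x \<Zcomp>\<^bsub>K\<^esub> y, u \<Zcomp>\<^bsub>K\<^esub> \<psi> g y) \<in> step\<^sup>+"
    using trancl_into_trancl by auto
  have m: "u \<in> Mor K" "v \<in> Mor K" using trancl_into_trancl step_Mor by auto
  obtain h where h: "h \<in> carrier G" "Tgt K v = \<phi> h (Tgt K u)"
    using step_orbO(2)[OF trancl_into_trancl(2)] orbO_eq_iff m Tgt_in by auto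
  have gy: "\<psi> g y \<in> Mor K" using g trancl_into_trancl by (simp add: functor_simps)
  have e: "\<psi> (h \<otimes>\<^bsub>G\<^esub> g) y = \<psi> h (\<psi> g y)"
    using on_Mor.composition_rule g h trancl_into_trancl by simp
  have t: "Tgt K v = Src K (\<psi> h (\<psi> g y))" using g h gy by (simp add: functor_simps)
  have "(\<psi> g y, \<psi> h (\<psi> g y)) \<in> step"
    using h gy by (simp add: step_orbM orbM_act functor_simps)
  from step_Cmp[OF trancl_into_trancl(2) this g(2) t] g(3)
  have "(x \<Zcomp>\<^bsub>K\<^esub> y, v \<Zcomp>\<^bsub>K\<^esub> \<psi> h (\<psi> g y)) \<in> step\<^sup>+" by auto
  moreover have "h \<otimes>\<^bsub>G\<^esub> g \<in> carrier G"
    using g h group_G by (simp add: group.is_monoid monoid.m_closed)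
  ultimately show ?case using e t by (intro bexI[of _ "h \<otimes>\<^bsub>G\<^esub> g"]) auto
qed

lemma rel_Cmp_right:
  "\<lbrakk>(y, y') \<in> rel; x \<in> Mor K; Tgt K x = Src K y\<rbrakk>
    \<Longrightarrow> \<exists>g \<in> carrier G. Tgt K (\<psi> g x) = Src K y' \<and> (x \<Zcomp>\<^bsub>K\<^esub> y, \<psi> g x \<Zcomp>\<^bsub>K\<^esub> y') \<in> rel"
  unfolding quotient_rel_def
proof (induction rule: trancl.induct)
  case (r_into_trancl y y')
  have m: "y \<in> Mor K" "y' \<in> Mor K" using r_into_trancl step_Mor by auto
  obtain g where g: "g \<in> carrier G" "Src K y' = \<phi> g (Src K y)"
    using step_orbO(1)[OF r_into_trancl(1)] orbO_eq_iff m Src_in by auto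
  have t: "Tgt K (\<psi> g x) = Src K y'" using g r_into_trancl by (simp add: functor_simps)
  have "(x, \<psi> g x) \<in> step" using g r_into_trancl by (simp add: step_orbM orbM_act functor_simps)
  from step_Cmp[OF this r_into_trancl(1,3) t] show ?case
    using g(1) t by blast
next
  case (trancl_into_trancl y u v)
  obtain g where g: "g \<in> carrier G" "Tgt K (\<psi> g x) = Src K u"
    "(x \<Zcomp>\<^bsub>K\<^esub> y, \<psi> g x \<Zcomp>\<^bsub>K\<^esub> u) \<in> step\<^sup>+"
    using trancl_into_trancl by auto
  have m: "u \<in> Mor K" "v \<in> Mor K" using trancl_into_trancl step_Mor by auto
  obtain h where h: "h \<in> carrier G" "Src K v = \<phi> h (Src K u)"
    using step_orbO(1)[OF trancl_into_trancl(2)] orbO_eq_iff m Src_in by auto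
  have gx: "\<psi> g x \<in> Mor K" using g trancl_into_trancl by (simp add: functor_simps)
  have e: "\<psi> (h \<otimes>\<^bsub>G\<^esub> g) x = \<psi> h (\<psi> g x)"
    using on_Mor.composition_rule g h trancl_into_trancl by simp
  have t: "Tgt K (\<psi> h (\<psi> g x)) = Src K v" using g h gx by (simp add: functor_simps)
  have "(\<psi> g x, \<psi> h (\<psi> g x)) \<in> step"
    using h gx by (simp add: step_orbM orbM_act functor_simps)
  from step_Cmp[OF this trancl_into_trancl(2) g(2) t] g(3)
  have "(x \<Zcomp>\<^bsub>K\<^esub> y, \<psi> h (\<psi> g x) \<Zcomp>\<^bsub>K\<^esub> v) \<in> step\<^sup>+" by auto
  moreover have "h \<otimes>\<^bsub>G\<^esub> g \<in> carrier G"
    using g h group_G by (simp add: group.is_monoid monoid.m_closed)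
  ultimately show ?case using e t by (intro bexI[of _ "h \<otimes>\<^bsub>G\<^esub> g"]) auto
qed

lemma rel_Cmp:
  assumes "(x, x') \<in> rel" "(y, y') \<in> rel" "Tgt K x = Src K y" "Tgt K x' = Src K y'"
  shows "(x \<Zcomp>\<^bsub>K\<^esub> y, x' \<Zcomp>\<^bsub>K\<^esub> y') \<in> rel"
proof -
  have m: "x \<in> Mor K" "x' \<in> Mor K" "y \<in> Mor K" "y' \<in> Mor K" using assms rel_Mor by auto
  obtain g where g: "g \<in> carrier G" "Tgt K x' = Src K (\<psi> g y)"
    and 1: "(x \<Zcomp>\<^bsub>K\<^esub> y, x' \<Zcomp>\<^bsub>K\<^esub> \<psi> g y) \<in> rel"
    using rel_Cmp_left[OF assms(1) m(3) assms(3)] by auto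
  have "(y, \<psi> g y) \<in> rel" using rel_act g m by auto
  then have "(\<psi> g y, y') \<in> rel"
    using assms(2) equiv_rel by (meson equivE symE rel_trans)
  from rel_Cmp_right[OF this m(2) g(2)]
  obtain h where h: "h \<in> carrier G" "Tgt K (\<psi> h x') = Src K y'"
    and 2: "(x' \<Zcomp>\<^bsub>K\<^esub> \<psi> g y, \<psi> h x' \<Zcomp>\<^bsub>K\<^esub> y') \<in> rel" by auto
  have "(\<psi> h x' \<Zcomp>\<^bsub>K\<^esub> y', x' \<Zcomp>\<^bsub>K\<^esub> y') \<in> rel"
    using h assms m by (intro rel_step step_Cmp step_orbM) (auto simp: functor_simps orbM_act)
  with 1 2 show ?thesis using rel_trans by blast
qed

lemma cls_eq_iff: "\<lbrakk>x \<in> Mor K; y \<in> Mor K\<rbrakk> \<Longrightarrow> cls x = cls y \<longleftrightarrow> (x, y) \<in> rel"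
  unfolding quotient_class_def using equiv_rel by (simp add: eq_equiv_class_iff)

lemma mem_cls_iff: "y \<in> cls x \<longleftrightarrow> (x, y) \<in> rel"
  by (simp add: quotient_class_def)

lemma self_in_cls: "x \<in> Mor K \<Longrightarrow> x \<in> cls x"
  unfolding mem_cls_iff by (simp add: rel_step step_orbM)

lemma Obj_quotient: "Obj Q = orbO ` Obj K"
  by (auto simp: quotient_category_def orbits_def)

lemma Mor_quotient: "Mor Q = cls ` Mor K"
  by (auto simp: quotient_category_def quotient_def quotient_class_def)

lemma Src_quotient:
  assumes "x \<in> Mor K"
  shows "{orbO (Src K y) | y. y \<in> cls x} = {orbO (Src K x)}" "Src Q (cls x) = orbO (Src K x)"
proof -
  show s: "{orbO (Src K y) | y. y \<in> cls x} = {orbO (Src K x)}"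
    using assms self_in_cls rel_orbO by (force simp: mem_cls_iff)
  then show "Src Q (cls x) = orbO (Src K x)" by (simp add: quotient_category_def s)
qed

lemma Tgt_quotient:
  assumes "x \<in> Mor K"
  shows "{orbO (Tgt K y) | y. y \<in> cls x} = {orbO (Tgt K x)}" "Tgt Q (cls x) = orbO (Tgt K x)"
proof -
  show s: "{orbO (Tgt K y) | y. y \<in> cls x} = {orbO (Tgt K x)}"
    using assms self_in_cls rel_orbO by (force simp: mem_cls_iff)
  then show "Tgt Q (cls x) = orbO (Tgt K x)" by (simp add: quotient_category_def s)
qed

lemma Idn_quotient:
  assumes "a \<in> Obj K"
  shows "{cls (Idn K b) | b. b \<in> orbO a} = {cls (Idn K a)}" "Idn Q (orbO a) = cls (Idn K a)"
proof -
  have "cls (Idn K (\<phi> g a)) = cls (Idn K a)" if g: "g \<in> carrier G" for g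
  proof -
    have "(Idn K a, \<psi> g (Idn K a)) \<in> rel" using g assms by (simp add: rel_act Idn_in)
    then have "cls (Idn K a) = cls (\<psi> g (Idn K a))" using rel_Mor cls_eq_iff by blast
    then show ?thesis using g assms by (simp add: functor_simps)
  qed
  then show s: "{cls (Idn K b) | b. b \<in> orbO a} = {cls (Idn K a)}"
    using on_Obj.orbit_refl[OF assms] by (fastforce simp: orbit_def)
  then show "Idn Q (orbO a) = cls (Idn K a)" by (simp add: quotient_category_def s)
qed

lemma Cmp_quotient:
  assumes "x \<in> Mor K" "y \<in> Mor K" "Tgt K x = Src K y"
  shows "{cls (x' \<Zcomp>\<^bsub>K\<^esub> y') | x' y'. x' \<in> cls x \<and> y' \<in> cls y \<and> Tgt K x' = Src K y'}
           = {cls (x \<Zcomp>\<^bsub>K\<^esub> y)}"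
    "cls x \<Zcomp>\<^bsub>Q\<^esub> cls y = cls (x \<Zcomp>\<^bsub>K\<^esub> y)"
proof -
  have "cls (x' \<Zcomp>\<^bsub>K\<^esub> y') = cls (x \<Zcomp>\<^bsub>K\<^esub> y)"
    if "x' \<in> cls x" "y' \<in> cls y" "Tgt K x' = Src K y'" for x' y'
    using that rel_Cmp[of x x' y y'] assms rel_Mor cls_eq_iff unfolding mem_cls_iff by blast
  then show s: "{cls (x' \<Zcomp>\<^bsub>K\<^esub> y') | x' y'. x' \<in> cls x \<and> y' \<in> cls y \<and> Tgt K x' = Src K y'}
           = {cls (x \<Zcomp>\<^bsub>K\<^esub> y)}"
    using assms self_in_cls by blast
  then show "cls x \<Zcomp>\<^bsub>Q\<^esub> cls y = cls (x \<Zcomp>\<^bsub>K\<^esub> y)" by (simp add: quotient_category_def s)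
qed

lemma composable_representative:
  assumes "a \<in> Obj K" "Y \<in> Mor Q" "Src Q Y = orbO a"
  obtains y where "y \<in> Mor K" "Y = cls y" "Src K y = a"
proof -
  obtain z where z: "z \<in> Mor K" "Y = cls z" using assms(2) by (auto simp: Mor_quotient)
  then have "orbO (Src K z) = orbO a" using assms(3) Src_quotient by simp
  then obtain g where g: "g \<in> carrier G" "a = \<phi> g (Src K z)"
    using orbO_eq_iff z assms Src_in by blast
  show thesis
  proof (rule that[of "\<psi> g z"])
    show "\<psi> g z \<in> Mor K" "Src K (\<psi> g z) = a" using g z by (auto simp: functor_simps)
    then show "Y = cls (\<psi> g z)" using g z rel_act cls_eq_iff by simp
  qed
qed

theorem category_quotient: "category Q"
proof
  fix X assume "X \<in> Mor Q"
  then obtain x where x: "x \<in> Mor K" "X = cls x" by (auto simp: Mor_quotient)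
  show "Src Q X \<in> Obj Q" "Tgt Q X \<in> Obj Q"
    using x by (auto simp: Src_quotient Tgt_quotient Obj_quotient Src_in Tgt_in)
  show "Idn Q (Src Q X) \<Zcomp>\<^bsub>Q\<^esub> X = X" "X \<Zcomp>\<^bsub>Q\<^esub> Idn Q (Tgt Q X) = X"
    using x by (auto simp: Src_quotient Tgt_quotient Idn_quotient Cmp_quotient
        Src_in Tgt_in Idn_in Src_Idn Tgt_Idn Idn_Cmp Cmp_Idn)
next
  fix A assume "A \<in> Obj Q"
  then obtain a where a: "a \<in> Obj K" "A = orbO a" by (auto simp: Obj_quotient)
  show "Idn Q A \<in> Mor Q" "Src Q (Idn Q A) = A" "Tgt Q (Idn Q A) = A"
    using a by (auto simp: Idn_quotient Mor_quotient Idn_in Src_quotient Tgt_quotient Src_Idn Tgt_Idn)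
next
  fix X Y assume "X \<in> Mor Q" "Y \<in> Mor Q" and e: "Tgt Q X = Src Q Y"
  then obtain x where x: "x \<in> Mor K" "X = cls x" by (auto simp: Mor_quotient)
  obtain y where y: "y \<in> Mor K" "Y = cls y" "Src K y = Tgt K x"
    using composable_representative[of "Tgt K x" Y] x e \<open>Y \<in> Mor Q\<close>
    by (auto simp: Tgt_quotient Tgt_in)
  show "X \<Zcomp>\<^bsub>Q\<^esub> Y \<in> Mor Q" "Src Q (X \<Zcomp>\<^bsub>Q\<^esub> Y) = Src Q X" "Tgt Q (X \<Zcomp>\<^bsub>Q\<^esub> Y) = Tgt Q Y"
    using x y by (auto simp: Cmp_quotient Mor_quotient Cmp_in Src_quotient Tgt_quotient
        Src_Cmp Tgt_Cmp)
next
  fix X Y Z assume "X \<in> Mor Q" "Y \<in> Mor Q" "Z \<in> Mor Q" 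
    and e: "Tgt Q X = Src Q Y" "Tgt Q Y = Src Q Z"
  then obtain x where x: "x \<in> Mor K" "X = cls x" by (auto simp: Mor_quotient)
  obtain y where y: "y \<in> Mor K" "Y = cls y" "Src K y = Tgt K x"
    using composable_representative[of "Tgt K x" Y] x e \<open>Y \<in> Mor Q\<close>
    by (auto simp: Tgt_quotient Tgt_in)
  obtain z where z: "z \<in> Mor K" "Z = cls z" "Src K z = Tgt K y"
    using composable_representative[of "Tgt K y" Z] y e \<open>Z \<in> Mor Q\<close>
    by (auto simp: Tgt_quotient Tgt_in)
  show "(X \<Zcomp>\<^bsub>Q\<^esub> Y) \<Zcomp>\<^bsub>Q\<^esub> Z = X \<Zcomp>\<^bsub>Q\<^esub> (Y \<Zcomp>\<^bsub>Q\<^esub> Z)"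
    using x y z by (simp add: Cmp_quotient Cmp_in Src_Cmp Tgt_Cmp Cmp_assoc)
qed

text \<open>The quotient is the colimit of the action: the projection is an invariant functor, and every
  invariant functor factors through it (uniquely, since the projection is surjective on objects
  and on morphisms).\<close>

theorem projection_invariant_functor:
  "cat_functor K Q orbO cls"
  "\<lbrakk>g \<in> carrier G; a \<in> Obj K\<rbrakk> \<Longrightarrow> orbO (\<phi> g a) = orbO a"
  "\<lbrakk>g \<in> carrier G; x \<in> Mor K\<rbrakk> \<Longrightarrow> cls (\<psi> g x) = cls x"
proof -
  show "cat_functor K Q orbO cls"
  proof (rule cat_functor.intro[OF category_axioms category_quotient], rule cat_functor_axioms.intro)
    show "orbO a \<in> Obj Q" "cls (Idn K a) = Idn Q (orbO a)" if "a \<in> Obj K" for a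
      using that by (simp_all add: Obj_quotient Idn_quotient(2))
    show "cls x \<in> Mor Q" "Src Q (cls x) = orbO (Src K x)" "Tgt Q (cls x) = orbO (Tgt K x)"
      if "x \<in> Mor K" for x
      using that by (simp_all add: Mor_quotient Src_quotient(2) Tgt_quotient(2))
    show "cls (x \<Zcomp>\<^bsub>K\<^esub> y) = cls x \<Zcomp>\<^bsub>Q\<^esub> cls y"
      if "x \<in> Mor K" "y \<in> Mor K" "Tgt K x = Src K y" for x y
      using that by (simp add: Cmp_quotient(2))
  qed
  show "orbO (\<phi> g a) = orbO a" if "g \<in> carrier G" "a \<in> Obj K"
    using that by (rule orbO_act)
  show "cls (\<psi> g x) = cls x" if "g \<in> carrier G" "x \<in> Mor K"
    using that rel_act[OF that] cls_eq_iff[of x "\<psi> g x"] by (simp add: functor_simps)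
qed

theorem invariant_functor_factors:
  assumes FH: "cat_functor K L F H"
    and F_inv: "\<And>g a. \<lbrakk>g \<in> carrier G; a \<in> Obj K\<rbrakk> \<Longrightarrow> F (\<phi> g a) = F a"
    and H_inv: "\<And>g x. \<lbrakk>g \<in> carrier G; x \<in> Mor K\<rbrakk> \<Longrightarrow> H (\<psi> g x) = H x"
  shows "\<exists>F' H'. cat_functor Q L F' H' \<and> (\<forall>a \<in> Obj K. F' (orbO a) = F a)
           \<and> (\<forall>x \<in> Mor K. H' (cls x) = H x)"
proof -
  interpret FH: cat_functor K L F H by (rule FH)
  have H_decomposition: "H x = H y"
    if "decomposition K xs x" "decomposition K ys y"
      "list_all2 (\<lambda>u v. orbM u = orbM v) xs ys" for xs ys x y
    using that
  proof (induction arbitrary: y ys rule: decomposition.induct)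
    case (single x)
    then obtain v where "ys = [v]" by (cases ys) auto
    with single have "y = v" "orbM x = orbM v" "v \<in> Mor K"
      by (auto elim: decomposition.cases)
    then show ?case using single H_inv orbM_eq_iff by metis
  next
    case (cons x zs z)
    obtain v vs where ys: "ys = v # vs" "orbM x = orbM v"
      "list_all2 (\<lambda>u v. orbM u = orbM v) zs vs"
      using cons by (cases ys) auto
    have "vs \<noteq> []" using ys cons decomposition_set by fastforce
    with cons(5) ys obtain w where w: "v \<in> Mor K" "decomposition K vs w" "Tgt K v = Src K w"
      "y = v \<Zcomp>\<^bsub>K\<^esub> w"
      by (auto elim: decomposition.cases)
    have "H x = H v" using ys w cons H_inv orbM_eq_iff by metis
    moreover have "H z = H w" using cons w ys by blast
    ultimately show ?case using w cons by (simp add: FH.mor_Cmp decomposition_Mor)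
  qed
  have H_step: "H x = H y" if "(x, y) \<in> step" for x y
    using that H_decomposition unfolding quotient_step_def by auto
  have H_rel: "H x = H y" if "(x, y) \<in> rel" for x y
    using that unfolding quotient_rel_def
    by (induction rule: trancl.induct) (auto dest: H_step)
  define F' where "F' = (\<lambda>A. F (SOME a. a \<in> Obj K \<and> A = orbO a))"
  define H' where "H' = (\<lambda>X. H (SOME x. x \<in> Mor K \<and> X = cls x))"
  have F': "F' (orbO a) = F a" if "a \<in> Obj K" for a
  proof -
    define b where "b = (SOME b. b \<in> Obj K \<and> orbO a = orbO b)"
    have "b \<in> Obj K \<and> orbO a = orbO b" unfolding b_def by (rule someI[of _ a]) (simp add: that)
    then have "F b = F a" using orbO_eq_iff that F_inv by metis
    then show ?thesis by (simp add: F'_def b_def)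
  qed
  have H': "H' (cls x) = H x" if "x \<in> Mor K" for x
  proof -
    define y where "y = (SOME y. y \<in> Mor K \<and> cls x = cls y)"
    have "y \<in> Mor K \<and> cls x = cls y" unfolding y_def by (rule someI[of _ x]) (simp add: that)
    then have "H x = H y" using cls_eq_iff that H_rel by blast
    then show ?thesis by (simp add: H'_def y_def)
  qed
  have "cat_functor Q L F' H'"
  proof (intro cat_functor.intro category_quotient cat_functor_axioms.intro FH.target.category_axioms)
    fix A assume "A \<in> Obj Q"
    then obtain a where a: "a \<in> Obj K" "A = orbO a" by (auto simp: Obj_quotient)
    show "F' A \<in> Obj L" "H' (Idn Q A) = Idn L (F' A)"
      using a by (auto simp: F' H' Idn_quotient Idn_in FH.obj_in FH.mor_Idn)
  next
    fix X assume "X \<in> Mor Q"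
    then obtain x where x: "x \<in> Mor K" "X = cls x" by (auto simp: Mor_quotient)
    show "H' X \<in> Mor L" "Src L (H' X) = F' (Src Q X)" "Tgt L (H' X) = F' (Tgt Q X)"
      using x by (auto simp: F' H' Src_quotient Tgt_quotient Src_in Tgt_in FH.mor_in
          FH.Src_mor FH.Tgt_mor)
  next
    fix X Y assume "X \<in> Mor Q" "Y \<in> Mor Q" and e: "Tgt Q X = Src Q Y"
    then obtain x where x: "x \<in> Mor K" "X = cls x" by (auto simp: Mor_quotient)
    obtain y where y: "y \<in> Mor K" "Y = cls y" "Src K y = Tgt K x"
      using composable_representative[of "Tgt K x" Y] x e \<open>Y \<in> Mor Q\<close>
      by (auto simp: Tgt_quotient Tgt_in)
    show "H' (X \<Zcomp>\<^bsub>Q\<^esub> Y) = H' X \<Zcomp>\<^bsub>L\<^esub> H' Y"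
      using x y by (simp add: Cmp_quotient H' Cmp_in FH.mor_Cmp)
  qed
  with F' H' show ?thesis by blast
qed

end

end

theory Submission
  imports Defs
begin

text \<open>For a regular action the generating relation of the quotient does not enlarge orbits: the
  factors of two orbitwise equal decompositions can be matched from the left, translating the
  remaining composite at each step. So the morphisms of the quotient are just the orbits, and
  (SR) says precisely that an orbit is determined by the orbits of its source and target. Given
  (SR), two opposite morphisms of the quotient lift to a composable pair \<open>a \<rightarrow> b \<rightarrow> g a\<close>, whose
  composite lies in the orbit of the identity of \<open>a\<close>; hence \<open>g a = a\<close>, and loopfreeness forces
  \<open>a = b\<close>.\<close>

context category_action
begin

lemma condition_SRD:
  "\<lbrakk>condition_SR G K \<phi> \<psi>; x \<in> Mor K; y \<in> Mor K; Src K x = Src K y;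
    orbO (Tgt K x) = orbO (Tgt K y)\<rbrakk> \<Longrightarrow> orbM x = orbM y"
  unfolding condition_SR_def by blast

lemma acts_regularlyD:
  "\<lbrakk>acts_regularly G K \<psi>; x \<in> Mor K; y \<in> Mor K; y' \<in> Mor K; Tgt K x = Src K y;
    Tgt K x = Src K y'; orbM y = orbM y'\<rbrakk> \<Longrightarrow> orbM (x \<Zcomp>\<^bsub>K\<^esub> y) = orbM (x \<Zcomp>\<^bsub>K\<^esub> y')"
  unfolding acts_regularly_def by blast

text \<open>Both composites start at the source of \<open>x\<close>, and their targets are those of
  \<open>y\<close> and \<open>y'\<close>, which share an orbit. So (SR) compares them
  directly.\<close>

lemma condition_SR_imp_acts_regularly:
  assumes "condition_SR G K \<phi> \<psi>"
  shows "acts_regularly G K \<psi>"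
  unfolding acts_regularly_def
proof (intro ballI impI)
  fix x y y'
  assume m: "x \<in> Mor K" "y \<in> Mor K" "y' \<in> Mor K"
    and e: "Tgt K x = Src K y \<and> Tgt K x = Src K y' \<and> orbM y = orbM y'"
  show "orbM (x \<Zcomp>\<^bsub>K\<^esub> y) = orbM (x \<Zcomp>\<^bsub>K\<^esub> y')"
    using m e orbM_imp_orbO(2)[of y y']
    by (intro condition_SRD[OF assms]) (auto simp: Cmp_in Src_Cmp Tgt_Cmp)
qed

lemma decomposition_orbM_eq:
  assumes reg: "acts_regularly G K \<psi>"
  shows "\<lbrakk>decomposition K xs x; decomposition K ys y;
      list_all2 (\<lambda>u v. orbM u = orbM v) xs ys\<rbrakk> \<Longrightarrow> orbM x = orbM y"
proof (induction arbitrary: y ys rule: decomposition.induct)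
  case (single x)
  then obtain v where "ys = [v]" by (cases ys) auto
  with single show ?case by (auto elim: decomposition.cases)
next
  case (cons x zs z)
  obtain v vs where ys: "ys = v # vs" "orbM x = orbM v"
    "list_all2 (\<lambda>u v. orbM u = orbM v) zs vs"
    using cons by (cases ys) auto
  \<comment> \<open>A nonempty tail rules out \<open>single\<close> when
    \<open>decomposition K ys y\<close> is inverted.\<close>
  have "vs \<noteq> []" using ys cons decomposition_set by fastforce
  with cons(5) ys obtain w where w: "v \<in> Mor K" "decomposition K vs w" "Tgt K v = Src K w"
    "y = v \<Zcomp>\<^bsub>K\<^esub> w"
    by (auto elim: decomposition.cases)
  have m: "z \<in> Mor K" "w \<in> Mor K" using cons w decomposition_Mor by auto
  \<comment> \<open>Regularity exchanges the second factor behind a fixed first one. The same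
    \<open>g\<close> is therefore applied to \<open>z\<close>, so that \<open>\<psi> g z\<close> and
    \<open>w\<close> both follow \<open>v\<close>.\<close>
  obtain g where g: "g \<in> carrier G" "v = \<psi> g x"
    using orbM_eq_iff cons(1) w(1) ys(2) by blast
  have gz: "\<psi> g z \<in> Mor K" "Src K (\<psi> g z) = Tgt K v"
    using g m cons by (simp_all add: functor_simps)
  have "orbM (\<psi> g z) = orbM w" using cons.IH[OF w(2) ys(3)] g m by (simp add: orbM_act)
  then have "orbM (v \<Zcomp>\<^bsub>K\<^esub> \<psi> g z) = orbM (v \<Zcomp>\<^bsub>K\<^esub> w)"
    using gz w m by (intro acts_regularlyD[OF reg]) simp_all
  moreover have "v \<Zcomp>\<^bsub>K\<^esub> \<psi> g z = \<psi> g (x \<Zcomp>\<^bsub>K\<^esub> z)"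
    using g m cons by (simp add: functor_simps)
  ultimately show ?case using g m cons w by (simp add: orbM_act Cmp_in)
qed

text \<open>Each generating step stays inside an orbit, and equality of orbits is transitive, so the
  transitive closure adds nothing.\<close>

lemma rel_iff_orbM_eq:
  assumes "acts_regularly G K \<psi>" "x \<in> Mor K" "y \<in> Mor K"
  shows "(x, y) \<in> rel \<longleftrightarrow> orbM x = orbM y"
proof
  have step: "orbM u = orbM v" if "(u, v) \<in> step" for u v
    using that decomposition_orbM_eq[OF assms(1)] unfolding quotient_step_def by auto
  show "orbM x = orbM y" if "(x, y) \<in> rel"
    using that unfolding quotient_rel_def
    by (induction rule: trancl.induct) (auto dest: step)
  show "(x, y) \<in> rel" if "orbM x = orbM y"
    using that assms by (simp add: rel_step step_orbM)
qed

text \<open>The classes of \<open>x\<close> and \<open>y\<close> are parallel in the quotient, hence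
  equal in a poset; regularity turns equal classes back into equal orbits.\<close>

lemma quotient_poset_imp_condition_SR:
  assumes "acts_regularly G K \<psi>" "poset_category Q"
  shows "condition_SR G K \<phi> \<psi>"
  unfolding condition_SR_def
proof (intro ballI impI)
  fix x y
  assume m: "x \<in> Mor K" "y \<in> Mor K"
    and e: "Src K x = Src K y \<and> orbO (Tgt K x) = orbO (Tgt K y)"
  have "cls x = cls y"
    using m e
    by (intro poset_category.parallel_eq[OF assms(2)])
      (simp_all add: Mor_quotient Src_quotient(2) Tgt_quotient(2))
  then show "orbM x = orbM y" using m cls_eq_iff rel_iff_orbM_eq[OF assms(1)] by simp
qed

lemma condition_SR_quotient_parallel_eq:
  assumes SR: "condition_SR G K \<phi> \<psi>"
    and X: "X \<in> Mor Q" and Y: "Y \<in> Mor Q"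
    and src: "Src Q X = Src Q Y" and tgt: "Tgt Q X = Tgt Q Y"
  shows "X = Y"
proof -
  obtain x where x: "x \<in> Mor K" "X = cls x" using X by (auto simp: Mor_quotient)
  have "Src Q Y = orbO (Src K x)" using src x Src_quotient(2) by simp
  \<comment> \<open>(SR) compares morphisms with the same source, not merely the same source orbit,
    so the representative of \<open>Y\<close> is translated to start where \<open>x\<close>
    does.\<close>
  with Src_in[OF x(1)] Y obtain y where y: "y \<in> Mor K" "Y = cls y" "Src K y = Src K x"
    by (rule composable_representative)
  have "orbO (Tgt K x) = orbO (Tgt K y)" using tgt x y by (simp add: Tgt_quotient)
  with condition_SRD[OF SR x(1) y(1) y(3)[symmetric]] have "orbM x = orbM y" .
  then show ?thesis using x y cls_eq_iff by (simp add: rel_step step_orbM)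
qed

lemma condition_SR_quotient_antisym:
  assumes SR: "condition_SR G K \<phi> \<psi>" and lf: "loopfree_category K"
    and X: "X \<in> Mor Q" and Y: "Y \<in> Mor Q"
    and XY: "Tgt Q X = Src Q Y" and YX: "Tgt Q Y = Src Q X"
  shows "Src Q X = Tgt Q X"
proof -
  obtain x where x: "x \<in> Mor K" "X = cls x" using X by (auto simp: Mor_quotient)
  obtain y where y: "y \<in> Mor K" "Y = cls y" "Src K y = Tgt K x"
    using composable_representative[OF Tgt_in[OF x(1)] Y] XY x Tgt_quotient(2) by metis
  let ?a = "Src K x"
  have a: "?a \<in> Obj K" using x Src_in by simp
  have xy: "x \<Zcomp>\<^bsub>K\<^esub> y \<in> Mor K" "Src K (x \<Zcomp>\<^bsub>K\<^esub> y) = ?a" "Tgt K (x \<Zcomp>\<^bsub>K\<^esub> y) = Tgt K y"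
    using x y by (simp_all add: Cmp_in Src_Cmp Tgt_Cmp)
  have "orbO (Tgt K y) = orbO ?a" using YX x y by (simp add: Src_quotient Tgt_quotient)
  then have "orbM (Idn K ?a) = orbM (x \<Zcomp>\<^bsub>K\<^esub> y)"
    using xy a by (intro condition_SRD[OF SR]) (simp_all add: Idn_in Src_Idn Tgt_Idn)
  then obtain g where g: "g \<in> carrier G" "x \<Zcomp>\<^bsub>K\<^esub> y = \<psi> g (Idn K ?a)"
    using orbM_eq_iff xy a Idn_in by blast
  \<comment> \<open>A translate of an identity is an identity, so its source and target
    agree.\<close>
  then have "Src K (x \<Zcomp>\<^bsub>K\<^esub> y) = Tgt K (x \<Zcomp>\<^bsub>K\<^esub> y)"
    using a by (simp add: functor_simps Idn_in Src_Idn Tgt_Idn)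
  then have closed: "Tgt K y = ?a" using xy by simp
  have "x \<Zcomp>\<^bsub>K\<^esub> y = Idn K ?a"
    using loopfree_category.endomorphism_is_identity[OF lf xy(1)] xy closed by simp
  \<comment> \<open>Once \<open>y\<close> returns to the source of \<open>x\<close>, the opposite
    composite is an endomorphism too, so \<open>x\<close> and \<open>y\<close> are mutually
    inverse.\<close>
  moreover have "y \<Zcomp>\<^bsub>K\<^esub> x = Idn K (Src K y)"
    using loopfree_category.endomorphism_is_identity[OF lf, of "y \<Zcomp>\<^bsub>K\<^esub> x"] x y closed
    by (simp add: Cmp_in Src_Cmp Tgt_Cmp)
  ultimately have "x = Idn K ?a"
    using loopfree_category.invertible_is_identity[OF lf, of x y] x y closed
    by (simp add: inverse_morphisms_def)
  then have "Tgt K x = ?a" using Tgt_Idn[OF a] by simp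
  then show ?thesis using x by (simp add: Src_quotient Tgt_quotient)
qed

text \<open>Reflexivity and transitivity come from identities and composition in the quotient;
  loopfreeness enters through antisymmetry.\<close>

lemma condition_SR_imp_quotient_poset:
  assumes SR: "condition_SR G K \<phi> \<psi>" and lf: "loopfree_category K"
  shows "poset_category Q"
proof -
  interpret Q: category Q by (rule category_quotient)
  let ?r = "{(Src Q X, Tgt Q X) | X. X \<in> Mor Q}"
  have "?r \<subseteq> Obj Q \<times> Obj Q" using Q.Src_in Q.Tgt_in by auto
  moreover have "refl_on (Obj Q) ?r"
  proof (rule refl_onI)
    fix A assume A: "A \<in> Obj Q"
    then have "(Src Q (Idn Q A), Tgt Q (Idn Q A)) \<in> ?r" using Q.Idn_in by blast
    then show "(A, A) \<in> ?r" using A by (simp add: Q.Src_Idn Q.Tgt_Idn)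
  qed
  moreover have "trans ?r"
  proof (rule transI)
    fix A B C assume "(A, B) \<in> ?r" "(B, C) \<in> ?r"
    then obtain X Y where XY: "X \<in> Mor Q" "Y \<in> Mor Q" "Tgt Q X = Src Q Y"
      and AC: "A = Src Q X" "C = Tgt Q Y"
      by auto
    have "(Src Q (X \<Zcomp>\<^bsub>Q\<^esub> Y), Tgt Q (X \<Zcomp>\<^bsub>Q\<^esub> Y)) \<in> ?r" using Q.Cmp_in[OF XY] by blast
    then show "(A, C) \<in> ?r" unfolding AC Q.Src_Cmp[OF XY] Q.Tgt_Cmp[OF XY] .
  qed
  moreover have "antisym ?r"
  proof (rule antisymI)
    fix A B assume "(A, B) \<in> ?r" "(B, A) \<in> ?r"
    then show "A = B" using condition_SR_quotient_antisym[OF SR lf] by auto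
  qed
  ultimately have "partial_order_on (Obj Q) ?r"
    by (simp add: partial_order_on_def preorder_on_def)
  then show ?thesis
    using condition_SR_quotient_parallel_eq[OF SR] by unfold_locales auto
qed

end

theorem proposition5p3p13:
  fixes K :: "('o, 'm) cat" and G :: "('g, 'r) monoid_scheme"
    and \<phi> :: "'g \<Rightarrow> 'o \<Rightarrow> 'o" and \<psi> :: "'g \<Rightarrow> 'm \<Rightarrow> 'm"
  assumes "loopfree_category K"
    and "category_action G K \<phi> \<psi>"
  shows "condition_SR G K \<phi> \<psi> \<longleftrightarrow>
    acts_regularly G K \<psi> \<and> poset_category (quotient_category G K \<phi> \<psi>)"
proof -
  interpret category_action G K \<phi> \<psi> by (rule assms(2))
  show ?thesis
    using condition_SR_imp_acts_regularly condition_SR_imp_quotient_poset[OF _ assms(1)]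
      quotient_poset_imp_condition_SR
    by blast
qed

end
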